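(* Let $\sigma=\sigma_1\sigma_2\cdots\sigma_k$ be a permutation of length $k\ge 2$, and let $\hat\sigma=\sigma_2\sigma_1\sigma_3\cdots\sigma_k$. If $\hat\sigma$ contains the pattern $231$, then $$\mathrm{Sort}(\sigma)=\mathfrak{S}\bigl(132,\mathcal{R}(\sigma)\bigr).$$ Therefore $\mathrm{Sort}(\sigma)$ is a permutation class with basis $\{132,\mathcal{R}(\sigma)\}$ if $\mathcal{R}(\sigma)$ avoids $132$, and with basis $\{132\}$ otherwise.
   Context: Permutations are written in one-line notation. A permutation $\pi$ contains a pattern $\tau$ if some (not necessarily consecutive) subsequence of $\pi$ is order isomorphic to $\tau$; otherwise $\pi$ avoids $\tau$. $\mathfrak{S}(\tau^{(1)},\tau^{(2)},\dots)$ is the set of all permutations avoiding all listed patterns. A permutation class is a set of permutations closed downwards under pattern containment; its basis is the set of permutations not in the class that are minimal with respect to pattern containment. $\mathcal{R}(\sigma)=\sigma_k\cdots\sigma_1$ is the reverse. For a permutation $\sigma$ of length at least $2$, the $\sigma$-stack acts on an input permutation $\pi=\pi_1\cdots\pi_n$ as follows (starting with empty stack and output). For $i=1,\dots,n$: as long as pushing $\pi_i$ on top of the stack would make the content of the stack, read from top to bottom, contain an occurrence of $\sigma$, pop the top element and append it to the output; then push $\pi_i$. After all letters have been pushed, pop all remaining elements, from top to bottom, appending them to the output. The resulting output is denoted $\mathcal{S}^{\sigma}(\pi)$. The permutation $\pi$ of length $n$ is $\sigma$-sortable if $\mathcal{S}^{21}(\mathcal{S}^{\sigma}(\pi))=12\cdots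 n$ (a pass through a $\sigma$-stack followed by a pass through a classical, i.e. $21$-avoiding, stack). $\mathrm{Sort}(\sigma)$ is the set of $\sigma$-sortable permutations. *)

theory Defs
  imports "HOL-Combinatorics.Multiset_Permutations" "HOL-Library.Sublist"
begin

text \<open>Permutations in one-line notation; the empty permutation (length 0) is included.\<close>

definition is_perm :: "nat list \<Rightarrow> bool" where
  "is_perm p \<longleftrightarrow> p \<in> permutations_of_set {1..length p}"

definition order_isomorphic :: "nat list \<Rightarrow> nat list \<Rightarrow> bool" where
  "order_isomorphic xs ys \<longleftrightarrow> length xs = length ys \<and>
     (\<forall>i < length xs. \<forall>j < length xs. xs ! i < xs ! j \<longleftrightarrow> ys ! i < ys ! j)"

text \<open>The first argument is an arbitrary word, since the content of a stack need not be a
  permutation of an initial segment of the positive integers.\<close>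

definition contains_pattern :: "nat list \<Rightarrow> nat list \<Rightarrow> bool" where
  "contains_pattern w t \<longleftrightarrow> (\<exists>ys. subseq ys w \<and> order_isomorphic ys t)"

abbreviation avoids_pattern :: "nat list \<Rightarrow> nat list \<Rightarrow> bool" where
  "avoids_pattern w t \<equiv> \<not> contains_pattern w t"

definition avoiders :: "nat list set \<Rightarrow> nat list set" where
  "avoiders T = {p. is_perm p \<and> (\<forall>t\<in>T. avoids_pattern p t)}"

definition is_perm_class :: "nat list set \<Rightarrow> bool" where
  "is_perm_class C \<longleftrightarrow> (\<forall>p\<in>C. is_perm p) \<and>
     (\<forall>p\<in>C. \<forall>t. is_perm t \<and> contains_pattern p t \<longrightarrow> t \<in> C)"

definition class_basis :: "nat list set \<Rightarrow> nat list set" where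
  "class_basis C = {p. is_perm p \<and> p \<notin> C \<and>
     (\<forall>t. is_perm t \<and> t \<notin> C \<and> contains_pattern p t \<longrightarrow> t = p)}"

text \<open>Stacks are lists with the top element first. \<open>stack_push s x st out\<close> pops elements of the
  stack \<open>st\<close> to the end of the output \<open>out\<close> as long as pushing \<open>x\<close> would create an occurrence of
  \<open>s\<close>, then pushes \<open>x\<close>; it returns the new stack and output. Pushing onto the empty stack is
  always allowed: a one-letter stack cannot contain a pattern of length at least 2, which is the
  only case of interest.\<close>

fun stack_push :: "nat list \<Rightarrow> nat \<Rightarrow> nat list \<Rightarrow> nat list \<Rightarrow> nat list \<times> nat list" where
  "stack_push s x [] out = ([x], out)"
| "stack_push s x (y # st) out =
     (if contains_pattern (x # y # st) s then stack_push s x st (out @ [y])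
      else (x # y # st, out))"

fun stack_run :: "nat list \<Rightarrow> nat list \<Rightarrow> nat list \<Rightarrow> nat list \<Rightarrow> nat list" where
  "stack_run s [] st out = out @ st"
| "stack_run s (x # xs) st out =
     (case stack_push s x st out of (st', out') \<Rightarrow> stack_run s xs st' out')"

definition stack_map :: "nat list \<Rightarrow> nat list \<Rightarrow> nat list" where
  "stack_map s p = stack_run s p [] []"

definition Sort :: "nat list \<Rightarrow> nat list set" where
  "Sort s = {p. is_perm p \<and> stack_map [2, 1] (stack_map s p) = [1..<Suc (length p)]}"

fun swap_first_two :: "nat list \<Rightarrow> nat list" where
  "swap_first_two (a # b # xs) = b # a # xs"
| "swap_first_two xs = xs"

end

theory Submission
  imports Defs
begin

text \<open>
  A push that leaves the stack alone happens exactly when the pushed letter completes no occurrence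
  of \<open>\<sigma>\<close>.  If the input avoids \<open>rev \<sigma>\<close>, no letter is ever popped early and the \<open>\<sigma>\<close>-stack simply
  reverses its input (\<open>stack_run_avoiding\<close>).  Otherwise some push forces pops; let \<open>x\<close> be the
  letter pushed and \<open>y\<close> the last letter popped for it.  With \<open>x\<close> on top of \<open>y\<close> the stack would
  contain \<open>\<sigma>\<close>, but without either of them it does not, so \<open>x\<close> and \<open>y\<close> play the roles of the first
  two letters of \<open>\<sigma>\<close>, the other letters being still in the stack.  As \<open>y\<close> leaves before \<open>x\<close>, and \<open>x\<close> before the letters
  below it, the output contains \<open>\<sigma>\<close> with its first two letters exchanged
  (\<open>stack_run_containing\<close>), hence \<open>231\<close>.

  By Knuth's theorem (\<open>stack_map_21_sorts_iff\<close>) the second stack sorts exactly the words that avoid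
  \<open>231\<close>.  So an input containing \<open>rev \<sigma>\<close> is never sorted, and an input avoiding \<open>rev \<sigma>\<close> is sorted
  iff its reverse avoids \<open>231\<close>, that is, iff it avoids \<open>132\<close>.  The statement on bases
  is the general fact that an antichain of permutations is the basis of the class
  it defines (\<open>class_basis_avoiders\<close>).  The patterns \<open>132\<close> and \<open>rev \<sigma>\<close> form an antichain when
  \<open>rev \<sigma>\<close> avoids \<open>132\<close>, since \<open>\<sigma>\<close> has at least three letters; otherwise \<open>132\<close> alone
  defines the class.
\<close>

section \<open>Order isomorphism and pattern containment\<close>

text \<open>Pairing the corresponding letters turns order isomorphism into a condition on a set
  of pairs, which is inherited by sublists and does not depend on the order of the list.\<close>

lemma order_isomorphic_conv_pairs:
  "order_isomorphic xs ys \<longleftrightarrow> (\<exists>ps. xs = map fst ps \<and> ys = map snd ps \<and>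
     (\<forall>p\<in>set ps. \<forall>q\<in>set ps. fst p < fst q \<longleftrightarrow> snd p < snd q))"
proof
  assume iso: "order_isomorphic xs ys"
  then have "length xs = length ys" by (simp add: order_isomorphic_def)
  moreover have "\<forall>p\<in>set (zip xs ys). \<forall>q\<in>set (zip xs ys). fst p < fst q \<longleftrightarrow> snd p < snd q"
    using iso by (fastforce simp: order_isomorphic_def set_zip)
  ultimately show "\<exists>ps. xs = map fst ps \<and> ys = map snd ps \<and>
     (\<forall>p\<in>set ps. \<forall>q\<in>set ps. fst p < fst q \<longleftrightarrow> snd p < snd q)"
    by (intro exI[of _ "zip xs ys"]) simp
qed (auto simp: order_isomorphic_def)

lemma order_isomorphic_refl: "order_isomorphic xs xs"
  by (simp add: order_isomorphic_def)

lemma order_isomorphic_trans: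
  "order_isomorphic xs ys \<Longrightarrow> order_isomorphic ys zs \<Longrightarrow> order_isomorphic xs zs"
  by (simp add: order_isomorphic_def)

lemma order_isomorphic_rev:
  assumes "order_isomorphic xs ys"
  shows "order_isomorphic (rev xs) (rev ys)"
proof -
  obtain ps where "xs = map fst ps" "ys = map snd ps"
    "\<forall>p\<in>set ps. \<forall>q\<in>set ps. fst p < fst q \<longleftrightarrow> snd p < snd q"
    using assms unfolding order_isomorphic_conv_pairs by blast
  then show ?thesis
    unfolding order_isomorphic_conv_pairs by (intro exI[of _ "rev ps"]) (simp add: rev_map)
qed

lemma order_isomorphic_Cons:
  "order_isomorphic (x # xs) (y # ys) \<longleftrightarrow> order_isomorphic xs ys \<and>
     (\<forall>i<length xs. (x < xs ! i \<longleftrightarrow> y < ys ! i) \<and> (xs ! i < x \<longleftrightarrow> ys ! i < y))"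
  by (auto simp: order_isomorphic_def All_less_Suc2)

lemma order_isomorphic_swap:
  "order_isomorphic (x # y # zs) (a # b # cs) \<Longrightarrow> order_isomorphic (y # x # zs) (b # a # cs)"
  by (auto simp: order_isomorphic_Cons All_less_Suc2)

lemma contains_pattern_refl: "contains_pattern w w"
  unfolding contains_pattern_def using order_isomorphic_refl by blast

lemma contains_pattern_subseq:
  "contains_pattern v t \<Longrightarrow> subseq v w \<Longrightarrow> contains_pattern w t"
  unfolding contains_pattern_def using subseq_order.trans[of _ v w] by blast

lemma contains_pattern_length: "contains_pattern w t \<Longrightarrow> length t \<le> length w"
  unfolding contains_pattern_def order_isomorphic_def by (metis list_emb_length)

lemma contains_pattern_trans:
  assumes "contains_pattern w t" "contains_pattern t u"
  shows "contains_pattern w u"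
proof -
  obtain ys where ys: "subseq ys w" "order_isomorphic ys t"
    using assms(1) unfolding contains_pattern_def by blast
  obtain us where us: "subseq us t" "order_isomorphic us u"
    using assms(2) unfolding contains_pattern_def by blast
  obtain ps where ps: "ys = map fst ps" "t = map snd ps"
    "\<forall>p\<in>set ps. \<forall>q\<in>set ps. fst p < fst q \<longleftrightarrow> snd p < snd q"
    using ys(2) unfolding order_isomorphic_conv_pairs by blast
  obtain N where N: "us = nths t N"
    using us(1) unfolding subseq_conv_nths by blast
  \<comment> \<open>The occurrence of \<open>u\<close> in \<open>t\<close> is carried over by selecting the same positions in \<open>ys\<close>.\<close>
  have "\<forall>p\<in>set (nths ps N). \<forall>q\<in>set (nths ps N). fst p < fst q \<longleftrightarrow> snd p < snd q"
    using ps(3) set_nths_subset[of ps N] by blast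
  moreover have "nths ys N = map fst (nths ps N)" "us = map snd (nths ps N)"
    by (simp_all add: ps(1,2) N nths_map)
  ultimately have "order_isomorphic (nths ys N) us"
    unfolding order_isomorphic_conv_pairs by blast
  moreover have "subseq (nths ys N) w"
    by (rule subseq_order.trans[OF _ ys(1)]) (simp add: subseq_conv_nths exI[of _ N])
  ultimately show ?thesis
    unfolding contains_pattern_def using order_isomorphic_trans[OF _ us(2)] by blast
qed

lemma subseq_rev:
  assumes "subseq xs ys"
  shows "subseq (rev xs) (rev ys)"
  using assms
proof (induction rule: list_emb.induct)
  case (list_emb_Cons2 x y xs ys)
  then show ?case by (auto intro: list_emb_append_mono)
qed auto

lemma contains_pattern_rev_iff: "contains_pattern (rev w) (rev t) \<longleftrightarrow> contains_pattern w t"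
proof -
  have rev: "contains_pattern (rev w) (rev t)" if "contains_pattern w t" for w t
    using that unfolding contains_pattern_def
    by (meson order_isomorphic_rev subseq_rev)
  from rev[of w t] rev[of "rev w" "rev t"] show ?thesis by auto
qed

lemma contains_pattern_21_iff: "contains_pattern w [2, 1] \<longleftrightarrow> \<not> sorted w"
proof -
  have "contains_pattern w [2, 1] \<longleftrightarrow> (\<exists>b a. subseq [b, a] w \<and> a < b)" (is "?L \<longleftrightarrow> ?R")
  proof
    assume ?L
    then obtain ys where ys: "subseq ys w" "order_isomorphic ys [2, 1]"
      unfolding contains_pattern_def by blast
    then obtain b a where "ys = [b, a]"
      by (auto simp: order_isomorphic_def length_Suc_conv)
    then show ?R using ys by (auto simp: order_isomorphic_def All_less_Suc2)
  next
    assume ?R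
    then obtain b a where "subseq [b, a] w" "a < b" by blast
    moreover from this have "order_isomorphic [b, a] [2, 1]"
      by (simp add: order_isomorphic_def All_less_Suc2)
    ultimately show ?L unfolding contains_pattern_def by blast
  qed
  moreover have "(\<exists>b a. subseq [b, a] w \<and> a < b) \<longleftrightarrow> \<not> sorted w"
  proof (induction w)
    case (Cons x w)
    have "(\<exists>b a. subseq [b, a] (x # w) \<and> a < b) \<longleftrightarrow>
        (\<exists>a\<in>set w. a < x) \<or> (\<exists>b a. subseq [b, a] w \<and> a < b)"
    proof
      assume "\<exists>b a. subseq [b, a] (x # w) \<and> a < b"
      then show "(\<exists>a\<in>set w. a < x) \<or> (\<exists>b a. subseq [b, a] w \<and> a < b)"
        by (auto simp: subseq_singleton_left split: if_splits)
    next
      assume "(\<exists>a\<in>set w. a < x) \<or> (\<exists>b a. subseq [b, a] w \<and> a < b)"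
      then show "\<exists>b a. subseq [b, a] (x # w) \<and> a < b"
        by (meson list_emb_Cons subseq_Cons2 subseq_singleton_left)
    qed
    then show ?case using Cons by (auto simp: not_le)
  qed simp
  ultimately show ?thesis by simp
qed

lemma contains_pattern_231_iff:
  "contains_pattern w [2, 3, 1] \<longleftrightarrow> (\<exists>b c a. subseq [b, c, a] w \<and> a < b \<and> b < c)"
  (is "?L \<longleftrightarrow> ?R")
proof
  assume ?L
  then obtain ys where ys: "subseq ys w" "order_isomorphic ys [2, 3, 1]"
    unfolding contains_pattern_def by blast
  then obtain b c a where "ys = [b, c, a]"
    by (auto simp: order_isomorphic_def length_Suc_conv)
  then show ?R using ys by (auto simp: order_isomorphic_def All_less_Suc2)
next
  assume ?R
  then obtain b c a where "subseq [b, c, a] w" "a < b" "b < c" by blast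
  moreover from this have "order_isomorphic [b, c, a] [2, 3, 1]"
    by (simp add: order_isomorphic_def All_less_Suc2)
  ultimately show ?L unfolding contains_pattern_def by blast
qed


section \<open>Permutations, classes and bases\<close>

lemma is_perm_iff: "is_perm p \<longleftrightarrow> distinct p \<and> set p = {1..length p}"
  by (auto simp: is_perm_def permutations_of_set_def)

text \<open>A letter of a permutation exceeds by one the number of positions that hold a smaller
  letter, and this number is invariant under order isomorphism.\<close>

lemma is_perm_nth_conv_card:
  assumes "is_perm p" "i < length p"
  shows "p ! i = Suc (card {j. j < length p \<and> p ! j < p ! i})"
proof -
  have p: "distinct p" "set p = {1..length p}" using assms(1) by (auto simp: is_perm_iff)
  have "inj_on ((!) p) {j. j < length p \<and> p ! j < p ! i}"
    using p(1) by (auto simp: inj_on_def nth_eq_iff_index_eq)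
  then have "card {j. j < length p \<and> p ! j < p ! i}
      = card ((!) p ` {j. j < length p \<and> p ! j < p ! i})"
    by (simp add: card_image)
  also have "(!) p ` {j. j < length p \<and> p ! j < p ! i} = {x \<in> set p. x < p ! i}"
    by (auto simp: in_set_conv_nth)
  also have "\<dots> = {1..<p ! i}"
    using p(2) nth_mem[OF assms(2)] by auto
  finally show ?thesis
    using p(2) nth_mem[OF assms(2)] by auto
qed

lemma is_perm_order_isomorphic_eq:
  assumes "is_perm p" "is_perm q" "order_isomorphic p q"
  shows "p = q"
proof (rule nth_equalityI)
  show len: "length p = length q" using assms(3) by (simp add: order_isomorphic_def)
  fix i assume i: "i < length p"
  have "{j. j < length p \<and> p ! j < p ! i} = {j. j < length q \<and> q ! j < q ! i}"
    using assms(3) i by (auto simp: order_isomorphic_def)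
  then show "p ! i = q ! i"
    using is_perm_nth_conv_card[OF assms(1) i] is_perm_nth_conv_card[OF assms(2), of i] i len
    by simp
qed

lemma contains_pattern_length_eq:
  assumes "is_perm p" "is_perm q" "contains_pattern p q" "length p \<le> length q"
  shows "p = q"
proof -
  obtain ys where ys: "subseq ys p" "order_isomorphic ys q"
    using assms(3) unfolding contains_pattern_def by blast
  then have "length ys = length q" by (simp add: order_isomorphic_def)
  then have "length ys = length p"
    using list_emb_length[OF ys(1)] assms(4) by simp
  with ys(1) have "ys = p" by (rule subseq_same_length)
  then show ?thesis using is_perm_order_isomorphic_eq[OF assms(1,2)] ys(2) by simp
qed

lemma contains_pattern_antisym:
  assumes "is_perm p" "is_perm q" "contains_pattern p q" "contains_pattern q p"
  shows "p = q"
  using contains_pattern_length_eq[OF assms(1-3)] contains_pattern_length[OF assms(4)] .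

lemma is_perm_class_avoiders: "is_perm_class (avoiders T)"
  unfolding is_perm_class_def
proof (intro conjI ballI allI impI)
  fix p q assume p: "p \<in> avoiders T" and q: "is_perm q \<and> contains_pattern p q"
  have "avoids_pattern q t" if "t \<in> T" for t
    using that p q contains_pattern_trans[of p q t] by (auto simp: avoiders_def)
  then show "q \<in> avoiders T" using q by (simp add: avoiders_def)
qed (simp add: avoiders_def)

lemma class_basis_avoiders:
  assumes perms: "\<And>t. t \<in> T \<Longrightarrow> is_perm t"
    and antichain: "\<And>t u. t \<in> T \<Longrightarrow> u \<in> T \<Longrightarrow> contains_pattern t u \<Longrightarrow> t = u"
  shows "class_basis (avoiders T) = T"
proof (intro equalityI subsetI)
  fix p assume "p \<in> class_basis (avoiders T)"
  then have p: "is_perm p" "p \<notin> avoiders T"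
    "\<And>t. is_perm t \<Longrightarrow> t \<notin> avoiders T \<Longrightarrow> contains_pattern p t \<Longrightarrow> t = p"
    unfolding class_basis_def by blast+
  then obtain t where t: "t \<in> T" "contains_pattern p t" by (auto simp: avoiders_def)
  moreover have "t \<notin> avoiders T" using t(1) contains_pattern_refl by (auto simp: avoiders_def)
  ultimately show "p \<in> T" using p(3) perms by blast
next
  fix p assume p: "p \<in> T"
  have "t = p" if t: "is_perm t" "t \<notin> avoiders T" "contains_pattern p t" for t
  proof -
    obtain u where u: "u \<in> T" "contains_pattern t u" using t(1,2) by (auto simp: avoiders_def)
    then have "p = u" using antichain[OF p u(1)] contains_pattern_trans[OF t(3)] by simp
    then show ?thesis using contains_pattern_antisym[OF t(1) perms[OF p]] u(2) t(3) by simp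
  qed
  moreover have "p \<notin> avoiders T" using p contains_pattern_refl by (auto simp: avoiders_def)
  ultimately show "p \<in> class_basis (avoiders T)"
    using perms[OF p] by (simp add: class_basis_def)
qed


section \<open>A pass through a pattern-avoiding stack\<close>

lemma stack_push_decomp:
  obtains T D where "st = T @ D" "stack_push s x st out = (x # D, out @ T)"
    "T \<noteq> [] \<Longrightarrow> contains_pattern (x # last T # D) s"
    "D = [] \<or> avoids_pattern (x # D) s"
proof -
  have "\<exists>T D. st = T @ D \<and> stack_push s x st out = (x # D, out @ T) \<and>
    (T \<noteq> [] \<longrightarrow> contains_pattern (x # last T # D) s) \<and> (D = [] \<or> avoids_pattern (x # D) s)"
  proof (induction st arbitrary: out)
    case (Cons y st)
    show ?case
    proof (cases "contains_pattern (x # y # st) s")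
      case True
      obtain T D where "st = T @ D" "stack_push s x st (out @ [y]) = (x # D, (out @ [y]) @ T)"
        "T \<noteq> [] \<longrightarrow> contains_pattern (x # last T # D) s" "D = [] \<or> avoids_pattern (x # D) s"
        using Cons[of "out @ [y]"] by blast
      then show ?thesis
        using True by (intro exI[of _ "y # T"] exI[of _ D]) auto
    next
      case False
      then show ?thesis by (intro exI[of _ "[]"] exI[of _ "y # st"]) auto
    qed
  qed simp
  then show ?thesis using that by blast
qed

lemma mset_stack_run: "mset (stack_run s xs st out) = mset out + mset st + mset xs"
proof (induction xs arbitrary: st out)
  case (Cons x xs)
  obtain T D where "st = T @ D" "stack_push s x st out = (x # D, out @ T)"
    by (rule stack_push_decomp)
  then show ?case using Cons by simp
qed simp

lemma mset_stack_map: "mset (stack_map s p) = mset p"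
  by (simp add: stack_map_def mset_stack_run)

text \<open>Pops take letters from the front of \<open>st\<close> and pushes only add letters in front, so letters
  in the stack cannot overtake each other.\<close>

lemma subseq_stack_run: "subseq (out @ st) (stack_run s xs st out)"
proof (induction xs arbitrary: st out)
  case (Cons x xs)
  obtain T D where TD: "st = T @ D" "stack_push s x st out = (x # D, out @ T)"
    by (rule stack_push_decomp)
  have "subseq (out @ T @ D) (out @ T @ x # D)"
    by (intro list_emb_append_mono) auto
  then show ?case
    using Cons[of "out @ T" "x # D"] TD subseq_order.trans by force
qed simp

lemma stack_run_avoiding:
  "avoids_pattern (rev xs @ st) s \<Longrightarrow> stack_run s xs st out = out @ rev xs @ st"
proof (induction xs arbitrary: st out)
  case (Cons x xs)
  have "avoids_pattern (x # st) s"
    using Cons.prems contains_pattern_subseq[of "x # st"] by auto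
  then have "stack_push s x st out = (x # st, out)" by (cases st) auto
  then show ?case using Cons.IH[of "x # st" out] Cons.prems by simp
qed simp

text \<open>Here \<open>rev xs @ st\<close> is the content the stack would have if everything were pushed
  and nothing popped.  The occurrence of the swapped pattern arises at the first push that pops a
  letter: the last popped letter overtakes the pushed one.\<close>

lemma stack_run_containing:
  assumes "length s \<ge> 2" "avoids_pattern st s" "contains_pattern (rev xs @ st) s"
  shows "contains_pattern (stack_run s xs st out) (swap_first_two s)"
  using assms(2,3)
proof (induction xs arbitrary: st out)
  case (Cons x xs)
  obtain T D where TD: "st = T @ D" "stack_push s x st out = (x # D, out @ T)"
    "T \<noteq> [] \<Longrightarrow> contains_pattern (x # last T # D) s" "D = [] \<or> avoids_pattern (x # D) s"
    by (rule stack_push_decomp) blast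
  \<comment> \<open>If everything is popped, the one letter left is too short to contain \<open>s\<close>.\<close>
  have avoid_xD: "avoids_pattern (x # D) s"
    using TD(4) contains_pattern_length[of "x # D" s] assms(1) by force
  show ?case
  proof (cases "T = []")
    case True
    then show ?thesis using TD avoid_xD Cons.IH[of "x # D" out] Cons.prems(2) by simp
  next
    case False
    define y where "y = last T"
    have T: "T = butlast T @ [y]" using False by (simp add: y_def)
    have "subseq (y # D) st"
      using T TD(1) by (metis append.assoc append_Cons append_Nil list_emb_append2
          subseq_order.refl)
    then have avoid_yD: "avoids_pattern (y # D) s"
      using Cons.prems(1) contains_pattern_subseq by blast
    obtain ys where ys: "subseq ys (x # y # D)" "order_isomorphic ys s"
      using TD(3)[OF False] unfolding contains_pattern_def y_def by blast
    have no: "\<not> subseq ys (y # D)" "\<not> subseq ys (x # D)"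
      using ys(2) avoid_xD avoid_yD unfolding contains_pattern_def by blast+
    obtain ys' where ys': "ys = x # ys'" "subseq ys' (y # D)"
      using ys(1) no(1) by (cases rule: list_emb.cases) auto
    obtain zs where zs: "ys' = y # zs" "subseq zs D"
      using ys'(2) no(2) unfolding ys'(1) by (cases rule: list_emb.cases) auto
    obtain a b cs where s: "s = a # b # cs"
      using ys(2) unfolding ys'(1) zs(1) order_isomorphic_def
      by (cases s rule: swap_first_two.cases) auto
    have "order_isomorphic (y # x # zs) (swap_first_two s)"
      using ys(2) unfolding ys'(1) zs(1) s by (auto intro: order_isomorphic_swap)
    moreover have "subseq (y # x # zs) ((out @ T) @ x # D)"
    proof -
      have "subseq ([y] @ x # zs) ([y] @ x # D)" using zs(2) by simp
      moreover have "(out @ T) @ x # D = (out @ butlast T) @ [y] @ x # D"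
        by (subst T) simp
      ultimately show ?thesis by (metis append_Cons append_Nil list_emb_append2)
    qed
    then have "subseq (y # x # zs) (stack_run s (x # xs) st out)"
      using TD(2) subseq_stack_run[of "out @ T" "x # D" s xs] subseq_order.trans by auto
    ultimately show ?thesis unfolding contains_pattern_def by blast
  qed
qed simp


section \<open>The classical stack\<close>

lemma stack_push_21:
  "sorted st \<Longrightarrow> stack_push [2, 1] x st out =
     (x # dropWhile (\<lambda>y. y < x) st, out @ takeWhile (\<lambda>y. y < x) st)"
proof (induction st arbitrary: out)
  case (Cons y st)
  then have "contains_pattern (x # y # st) [2, 1] \<longleftrightarrow> y < x"
    unfolding contains_pattern_21_iff by auto
  then show ?case using Cons by simp
qed simp

text \<open>The content of a classical stack is increasing from top to bottom.  In
  an intermediate state the final output is sorted iff the letters already output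
  are in place and no pattern \<open>231\<close> is still to be completed; the letter playing \<open>2\<close> may
  already be in the stack, but the \<open>3\<close> pops it before the \<open>1\<close> arrives.\<close>

lemma sorted_stack_run_21_iff:
  assumes "sorted_wrt (<) st" "distinct (st @ xs)"
  shows "sorted_wrt (<) (stack_run [2, 1] xs st out) \<longleftrightarrow>
    sorted_wrt (<) out \<and> (\<forall>u\<in>set out. \<forall>z\<in>set st \<union> set xs. u < z) \<and>
    (\<forall>b\<in>set st. \<forall>c a. subseq [c, a] xs \<longrightarrow> \<not> (a < b \<and> b < c)) \<and>
    (\<forall>b c a. subseq [b, c, a] xs \<longrightarrow> \<not> (a < b \<and> b < c))"
  using assms
proof (induction xs arbitrary: st out)
  case Nil
  then show ?case by (auto simp: sorted_wrt_append)
next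
  case (Cons x xs)
  define T where "T = takeWhile (\<lambda>y. y < x) st"
  define D where "D = dropWhile (\<lambda>y. y < x) st"
  have st: "st = T @ D" by (simp add: T_def D_def)
  have push: "stack_push [2, 1] x st out = (x # D, out @ T)"
    using Cons.prems(1) unfolding T_def D_def
    by (intro stack_push_21) (simp add: strict_sorted_iff)
  have sT: "sorted_wrt (<) T" and sD: "sorted_wrt (<) D"
    and TD: "\<forall>u\<in>set T. \<forall>v\<in>set D. u < v"
    using Cons.prems(1) unfolding st by (auto simp: sorted_wrt_append)
  have Tx: "\<forall>u\<in>set T. u < x" unfolding T_def by (auto dest: set_takeWhileD)
  have xD: "\<forall>v\<in>set D. x < v"
  proof (cases D)
    case (Cons d D')
    then have "\<not> d < x" unfolding D_def by (simp add: dropWhile_eq_Cons_conv)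
    moreover have "d \<noteq> x" using Cons.prems(2) st Cons by auto
    ultimately show ?thesis using sD Cons by auto
  qed simp
  have dist: "distinct ((x # D) @ xs)" and Txs: "set T \<inter> set xs = {}"
    using Cons.prems(2) unfolding st by auto
  have IH: "sorted_wrt (<) (stack_run [2, 1] xs (x # D) (out @ T)) \<longleftrightarrow>
    sorted_wrt (<) (out @ T) \<and> (\<forall>u\<in>set (out @ T). \<forall>z\<in>set (x # D) \<union> set xs. u < z) \<and>
    (\<forall>b\<in>set (x # D). \<forall>c a. subseq [c, a] xs \<longrightarrow> \<not> (a < b \<and> b < c)) \<and>
    (\<forall>b c a. subseq [b, c, a] xs \<longrightarrow> \<not> (a < b \<and> b < c))"
    using sD xD dist by (intro Cons.IH) auto
  have tail: "a \<in> set xs" if "subseq [c, a] xs" for c a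
    using subseq_Cons'[OF that] by (simp add: subseq_singleton_left)
  \<comment> \<open>Pairs \<open>c a\<close> starting with \<open>c = x\<close> say that the popped letters \<open>T\<close> precede all later ones.\<close>
  have pairs: "(\<forall>b\<in>set st. \<forall>c a. subseq [c, a] (x # xs) \<longrightarrow> \<not> (a < b \<and> b < c)) \<longleftrightarrow>
    (\<forall>u\<in>set T. \<forall>z\<in>set xs. u < z) \<and>
    (\<forall>b\<in>set D. \<forall>c a. subseq [c, a] xs \<longrightarrow> \<not> (a < b \<and> b < c))" (is "?L \<longleftrightarrow> ?R")
  proof
    assume L: ?L
    have "u < z" if "u \<in> set T" "z \<in> set xs" for u z
    proof -
      have "subseq [x, z] (x # xs)" using that by (simp add: subseq_singleton_left)
      then have "\<not> z < u" using L that Tx st by auto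
      moreover have "u \<noteq> z" using Txs that by auto
      ultimately show ?thesis by simp
    qed
    moreover have "\<not> (a < b \<and> b < c)" if "b \<in> set D" "subseq [c, a] xs" for b c a
      using L that(1) list_emb_Cons[OF that(2)] unfolding st by simp blast
    ultimately show ?R by blast
  next
    assume R: ?R
    show ?L
    proof (intro ballI allI impI notI)
      fix b c a assume b: "b \<in> set st" and ca: "subseq [c, a] (x # xs)" and "a < b \<and> b < c"
      then have a: "a < b" "b < c" by auto
      show False
      proof (cases "b \<in> set T")
        case True
        moreover have "a \<in> set xs" using ca tail by (auto simp: subseq_singleton_left split: if_splits)
        ultimately show False using R a by force
      next
        case False
        then have bD: "b \<in> set D" using b st by auto
        then have "c \<noteq> x" using a xD by force
        then have "subseq [c, a] xs" using ca by auto
        then show False using R bD a by blast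
      qed
    qed
  qed
  have triples: "(\<forall>b c a. subseq [b, c, a] (x # xs) \<longrightarrow> \<not> (a < b \<and> b < c)) \<longleftrightarrow>
    (\<forall>c a. subseq [c, a] xs \<longrightarrow> \<not> (a < x \<and> x < c)) \<and>
    (\<forall>b c a. subseq [b, c, a] xs \<longrightarrow> \<not> (a < b \<and> b < c))"
    by (auto dest: subseq_Cons')
  show ?case
    unfolding pairs triples stack_run.simps push prod.case IH
    using sT TD Tx unfolding st by (auto simp: sorted_wrt_append)
qed

text \<open>Knuth's characterization of the stack sortable permutations.\<close>

lemma stack_map_21_sorts_iff:
  assumes "is_perm w"
  shows "stack_map [2, 1] w = [1..<Suc (length w)] \<longleftrightarrow> avoids_pattern w [2, 3, 1]"
proof -
  have set: "set (stack_map [2, 1] w) = {1..length w}"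
    using mset_eq_setD[OF mset_stack_map[of "[2, 1]" w]] assms unfolding is_perm_iff by simp
  have "stack_map [2, 1] w = [1..<Suc (length w)] \<longleftrightarrow> sorted_wrt (<) (stack_map [2, 1] w)"
  proof
    assume "sorted_wrt (<) (stack_map [2, 1] w)"
    moreover have "sorted_wrt (<) [1..<Suc (length w)]" by (rule sorted_wrt_upt)
    moreover have "set (stack_map [2, 1] w) = set [1..<Suc (length w)]"
      unfolding set by (simp add: atLeastLessThanSuc_atLeastAtMost del: upt_Suc)
    ultimately show "stack_map [2, 1] w = [1..<Suc (length w)]"
      using strict_sorted_equal by blast
  next
    assume "stack_map [2, 1] w = [1..<Suc (length w)]"
    then show "sorted_wrt (<) (stack_map [2, 1] w)" by (simp del: upt_Suc)
  qed
  also have "\<dots> \<longleftrightarrow> avoids_pattern w [2, 3, 1]"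
    unfolding stack_map_def contains_pattern_231_iff
    using sorted_stack_run_21_iff[of "[]" w "[]"] assms by (auto simp: is_perm_iff)
  finally show ?thesis .
qed


section \<open>The sortable permutations\<close>

lemma contains_pattern_231_rev_iff:
  "contains_pattern (rev p) [2, 3, 1] \<longleftrightarrow> contains_pattern p [1, 3, 2]"
  using contains_pattern_rev_iff[of p "[1, 3, 2]"] by simp

lemma Sort_eq_avoiders:
  assumes "length s \<ge> 2" "contains_pattern (swap_first_two s) [2, 3, 1]"
  shows "Sort s = avoiders {[1, 3, 2], rev s}"
proof -
  have "stack_map [2, 1] (stack_map s p) = [1..<Suc (length p)] \<longleftrightarrow>
      avoids_pattern p [1, 3, 2] \<and> avoids_pattern p (rev s)" if p: "is_perm p" for p
  proof -
    have len: "length (stack_map s p) = length p"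
      using mset_stack_map by (rule mset_eq_length)
    have "is_perm (stack_map s p)"
      using p len mset_eq_setD[OF mset_stack_map[of s p]]
        mset_eq_imp_distinct_iff[OF mset_stack_map[of s p]]
      unfolding is_perm_iff by simp
    then have "stack_map [2, 1] (stack_map s p) = [1..<Suc (length p)] \<longleftrightarrow>
        avoids_pattern (stack_map s p) [2, 3, 1]"
      using stack_map_21_sorts_iff[of "stack_map s p"] len by simp
    also have "\<dots> \<longleftrightarrow> avoids_pattern p [1, 3, 2] \<and> avoids_pattern p (rev s)"
    proof (cases "contains_pattern p (rev s)")
      case True
      then have "contains_pattern (rev p) s" using contains_pattern_rev_iff[of p "rev s"] by simp
      moreover have "avoids_pattern [] s" using contains_pattern_length[of "[]" s] assms(1) by auto
      ultimately have "contains_pattern (stack_map s p) (swap_first_two s)"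
        unfolding stack_map_def using stack_run_containing[OF assms(1), of "[]" p "[]"] by simp
      then show ?thesis using True contains_pattern_trans[OF _ assms(2)] by simp
    next
      case False
      then have "avoids_pattern (rev p @ []) s" using contains_pattern_rev_iff[of p "rev s"] by simp
      then have "stack_map s p = rev p" unfolding stack_map_def by (subst stack_run_avoiding) auto
      then show ?thesis using False contains_pattern_231_rev_iff by simp
    qed
    finally show ?thesis .
  qed
  then show ?thesis unfolding Sort_def avoiders_def by blast
qed

lemma length_swap_first_two: "length (swap_first_two s) = length s"
  by (cases s rule: swap_first_two.cases) auto

theorem theorem3p6:
  fixes \<sigma> :: "nat list"
  assumes "is_perm \<sigma>"
    and "length \<sigma> \<ge> 2"
    and "contains_pattern (swap_first_two \<sigma>) [2, 3, 1]"
  shows "Sort \<sigma> = avoiders {[1, 3, 2], rev \<sigma>} \<and>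
    is_perm_class (Sort \<sigma>) \<and>
    (avoids_pattern (rev \<sigma>) [1, 3, 2] \<longrightarrow> class_basis (Sort \<sigma>) = {[1, 3, 2], rev \<sigma>}) \<and>
    (contains_pattern (rev \<sigma>) [1, 3, 2] \<longrightarrow> class_basis (Sort \<sigma>) = {[1, 3, 2]})"
proof (intro conjI impI)
  show Sort: "Sort \<sigma> = avoiders {[1, 3, 2], rev \<sigma>}"
    using assms(2,3) by (rule Sort_eq_avoiders)
  show "is_perm_class (Sort \<sigma>)"
    unfolding Sort by (rule is_perm_class_avoiders)
  have perm132: "is_perm [1, 3, 2]" by (auto simp: is_perm_iff)
  have permrev: "is_perm (rev \<sigma>)" using assms(1) by (simp add: is_perm_iff)
  {
    assume avoid: "avoids_pattern (rev \<sigma>) [1, 3, 2]"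
    \<comment> \<open>Length at least \<open>3\<close> leaves \<open>132\<close> itself as the only possible pattern \<open>rev \<sigma>\<close> of \<open>132\<close>.\<close>
    have "length [1, 3, 2 :: nat] \<le> length (rev \<sigma>)"
      using contains_pattern_length[OF assms(3)] by (simp add: length_swap_first_two)
    then have "avoids_pattern [1, 3, 2] (rev \<sigma>)"
      using contains_pattern_length_eq[OF perm132 permrev] avoid contains_pattern_refl by metis
    then show "class_basis (Sort \<sigma>) = {[1, 3, 2], rev \<sigma>}"
      unfolding Sort by (intro class_basis_avoiders) (use avoid perm132 permrev in auto)
  next
    assume contains: "contains_pattern (rev \<sigma>) [1, 3, 2]"
    have "contains_pattern p [1, 3, 2]" if "contains_pattern p (rev \<sigma>)" for p
      using that contains by (rule contains_pattern_trans)
    then have "avoiders {[1, 3, 2], rev \<sigma>} = avoiders {[1, 3, 2]}"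
      unfolding avoiders_def by blast
    then have "Sort \<sigma> = avoiders {[1, 3, 2]}" using Sort by simp
    moreover have "class_basis (avoiders {[1, 3, 2]}) = {[1, 3, 2]}"
      using perm132 by (intro class_basis_avoiders) auto
    ultimately show "class_basis (Sort \<sigma>) = {[1, 3, 2]}" by simp
  }
qed

end
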